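(* Let $(X,d,\nu)$ be a measured length space satisfying the $BBL(0,N)$ condition. Then the support of $\nu$ has Hausdorff dimension $\leq N$.
   Context: A length space is a metric space $(X,d)$ in which the distance between two points is the infimum of the lengths of curves joining them. A measured length space $(X,d,\nu)$ is a length space with a Borel probability measure $\nu$. For $x,y\in X$ and $t\in[0,1]$, $Z_t(x,y)$ is the set of $z\in X$ with $d(x,z)=t\,d(x,y)$ and $d(z,y)=(1-t)\,d(x,y)$. For $p\in\mathbb{R}\setminus\{0\}$, $t\in[0,1]$ and $a,b\geq 0$, the $p$-mean is $\mathcal{M}_t^p(a,b):=((1-t)a^p+tb^p)^{1/p}$ if $ab\neq0$ and $\mathcal{M}_t^p(a,b):=0$ if $ab=0$. For $p=0$, $\mathcal{M}_t^0(a,b):=a^{1-t}b^t$ if $ab\neq 0$ and $0$ if $ab=0$. Also $\mathcal{M}_t^{-\infty}(a,b):=\min(a,b)$. For real $N\geq1$ and $p\geq-1/N$, $(X,d,\nu)$ satisfies $BBL_p(0,N)$ if for every $t\in[0,1]$ and every triple of ($\nu$-integrable) functions $f,g,h:X\to\mathbb{R}_+$ satisfying $h(z)\geq\mathcal{M}_t^p(f(x),g(y))$ for all $x,y\in X$ and $z\in Z_t(x,y)$, one has $$\int_X h\,d\nu\geq\mathcal{M}_t^{p/(1+Np)}\left(\int_X f\,d\nu,\int_X g\,d\nu\right),$$ where for $p=-1/N$ the exponent $p/(1+Np)$ is understood as $-\infty$. $(X,d,\nu)$ satisfies $BBL(0,N)$ if it satisfies $BBL_p(0,N)$ for every $p\geq-1/N$.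 *)

theory Defs
  imports "HOL-Probability.Probability"
begin

definition curve_length :: "(real \<Rightarrow> 'a::metric_space) \<Rightarrow> ennreal" where
  "curve_length \<gamma> =
     (SUP s \<in> {s :: nat \<Rightarrow> real. incseq s \<and> range s \<subseteq> {0..1}}. SUP n.
        ennreal (\<Sum>i<n. dist (\<gamma> (s i)) (\<gamma> (s (Suc i)))))"

locale measured_length_space = prob_space M for M :: "'a::metric_space measure" +
  assumes sets_eq_borel: "sets M = sets borel"
    and dist_eq_Inf_curve_length:
      "\<And>x y :: 'a. ennreal (dist x y) =
         (INF \<gamma> \<in> {\<gamma>. path \<gamma> \<and> pathstart \<gamma> = x \<and> pathfinish \<gamma> = y}. curve_length \<gamma>)"

definition intermediate_points :: "real \<Rightarrow> 'a::metric_space \<Rightarrow> 'a \<Rightarrow> 'a set" where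
  "intermediate_points t x y = {z. dist x z = t * dist x y \<and> dist z y = (1 - t) * dist x y}"

(* The value at exponent \<infinity> is the customary one; it is not used below. *)
definition p_mean :: "ereal \<Rightarrow> real \<Rightarrow> real \<Rightarrow> real \<Rightarrow> real" where
  "p_mean q t a b =
     (case q of
        ereal p \<Rightarrow>
          if a * b = 0 then 0
          else if p = 0 then a powr (1 - t) * b powr t
          else ((1 - t) * a powr p + t * b powr p) powr (1 / p)
      | MInfty \<Rightarrow> min a b
      | PInfty \<Rightarrow> if a * b = 0 then 0 else max a b)"

definition BBL_exponent :: "real \<Rightarrow> real \<Rightarrow> ereal" where
  "BBL_exponent p N = (if p = - 1 / N then -\<infinity> else ereal (p / (1 + N * p)))"

definition BBL_p :: "real \<Rightarrow> real \<Rightarrow> 'a::metric_space measure \<Rightarrow> bool" where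
  "BBL_p p N M \<longleftrightarrow>
     (\<forall>t\<in>{0..1}. \<forall>f g h :: 'a \<Rightarrow> real.
        (\<forall>x. 0 \<le> f x) \<and> (\<forall>x. 0 \<le> g x) \<and> (\<forall>x. 0 \<le> h x) \<and>
        integrable M f \<and> integrable M g \<and> integrable M h \<and>
        (\<forall>x y. \<forall>z\<in>intermediate_points t x y. h z \<ge> p_mean (ereal p) t (f x) (g y))
        \<longrightarrow> (\<integral>x. h x \<partial>M) \<ge>
              p_mean (BBL_exponent p N) t (\<integral>x. f x \<partial>M) (\<integral>x. g x \<partial>M))"

definition BBL :: "real \<Rightarrow> 'a::metric_space measure \<Rightarrow> bool" where
  "BBL N M \<longleftrightarrow> (\<forall>p \<ge> - 1 / N. BBL_p p N M)"

definition measure_support :: "'a::metric_space measure \<Rightarrow> 'a set" where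
  "measure_support M = {x. \<forall>U. open U \<and> x \<in> U \<longrightarrow> emeasure M U > 0}"

(* The convention is diam(U)^0 = 1 for nonempty U, whereas 0 powr 0 = 0. *)
definition diameter_power :: "real \<Rightarrow> 'a::metric_space set \<Rightarrow> ennreal" where
  "diameter_power s U =
     (if U = {} then 0 else if s = 0 then 1 else ennreal (diameter U powr s))"

(* Boundedness is required because diameter is only meaningful for bounded sets. *)
definition hausdorff_premeasure :: "real \<Rightarrow> real \<Rightarrow> 'a::metric_space set \<Rightarrow> ennreal" where
  "hausdorff_premeasure s \<delta> A =
     (INF U \<in> {U :: nat \<Rightarrow> 'a set.
                 (\<forall>i. bounded (U i) \<and> diameter (U i) \<le> \<delta>) \<and> A \<subseteq> (\<Union>i. U i)}.
        \<Sum>i. diameter_power s (U i))"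

definition hausdorff_measure :: "real \<Rightarrow> 'a::metric_space set \<Rightarrow> ennreal" where
  "hausdorff_measure s A = (SUP \<delta>\<in>{0<..}. hausdorff_premeasure s \<delta> A)"

definition hausdorff_dim :: "'a::metric_space set \<Rightarrow> ennreal" where
  "hausdorff_dim A = Inf {ennreal s | s. 0 \<le> s \<and> hausdorff_measure s A = 0}"

end

theory Submission
  imports Defs
begin

text \<open>
  The Borell-Brascamp-Lieb condition is used through the Brunn-Minkowski inequality. Apply it to
  indicator functions of \<open>A\<close>, \<open>B\<close> and a set \<open>C\<close> containing all \<open>t\<close>-intermediate points between
  them: the means of their values are \<open>0\<close> or \<open>1\<close> for every exponent \<open>p > 0\<close>, and if \<open>A\<close> and \<open>B\<close> have
  positive measure the conclusion is
  \<open>\<nu>(C)\<^sup>q \<ge> (1-t) \<nu>(A)\<^sup>q + t \<nu>(B)\<^sup>q\<close> with \<open>1/q = N + 1/p\<close>.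
  Thus every exponent \<open>N' = 1/q\<close> larger than \<open>N\<close> is available.

  Take for \<open>A\<close> a tiny ball around a point \<open>x\<close> of the support and for \<open>B\<close> the ball of radius \<open>R\<close>
  around \<open>x\<close>. The intermediate points stay in a ball of radius \<open>2tR\<close>, and \<open>\<nu>(A) > 0\<close>, so
  that \<open>\<nu>(B(x,2tR)) \<ge> t\<^sup>N\<^sup>' \<nu>(B(x,R))\<close> (lemma \<open>BBL_p_imp_measure_cball_ge\<close>), a crude
  Bishop-Gromov inequality. Hence on a bounded part of the support the mass of a ball of radius
  \<open>r\<close> is at least \<open>c r\<^sup>N\<^sup>'\<close> with a uniform \<open>c > 0\<close>. Since the total mass is \<open>1\<close>, at most
  \<open>O(r\<^sup>-\<^sup>N\<^sup>')\<close> disjoint such balls fit, and a maximal separated set gives a cover by that many balls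
  of radius comparable to \<open>r\<close> (lemma \<open>finite_cover_of_measure_cball_ge\<close>). For \<open>s > N'\<close> the
  sum of the \<open>s\<close>-th powers of the diameters tends to \<open>0\<close> with \<open>r\<close>. Bounded pieces of the support
  are therefore null for the \<open>s\<close>-dimensional Hausdorff measure, and by countable subadditivity so
  is the support itself.
\<close>

section \<open>Hausdorff premeasures\<close>

lemma diameter_power_empty [simp]: "diameter_power s {} = 0"
  by (simp add: diameter_power_def)

lemma hausdorff_premeasure_le_suminf:
  assumes "\<And>i. bounded (U i)" "\<And>i. diameter (U i) \<le> \<delta>" "A \<subseteq> (\<Union>i. U i)"
  shows "hausdorff_premeasure s \<delta> A \<le> (\<Sum>i. diameter_power s (U i))"
  unfolding hausdorff_premeasure_def
  by (rule INF_lower) (use assms in auto)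

lemma hausdorff_premeasure_le_of_finite_cover:
  fixes A :: "'a::metric_space set"
  assumes "finite F" "A \<subseteq> (\<Union>x\<in>F. cball x r)" "0 < r" "2 * r \<le> \<delta>" "0 < s"
  shows "hausdorff_premeasure s \<delta> A \<le> ennreal (card F * (2 * r) powr s)"
proof -
  obtain e where e: "bij_betw e {..<card F} F"
    using ex_bij_betw_nat_finite[OF \<open>finite F\<close>] by (auto simp: lessThan_atLeast0)
  define U where "U i = (if i < card F then cball (e i) r else {})" for i
  have diam: "diameter (cball x r) \<le> 2 * r" for x :: 'a
  proof -
    have "dist y z \<le> 2 * r" if "y \<in> cball x r" "z \<in> cball x r" for y z
      using that dist_triangle3[of y z x] by simp
    then show ?thesis
      using \<open>0 < r\<close> by (auto simp: diameter_def intro!: cSUP_least)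
  qed
  have pow: "diameter_power s (cball x r) \<le> ennreal ((2 * r) powr s)" for x :: 'a
    using \<open>0 < s\<close> diam[of x] by (auto simp: diameter_power_def intro!: ennreal_leI powr_mono2 diameter_ge_0)
  have "A \<subseteq> (\<Union>i. U i)"
  proof
    fix a assume "a \<in> A"
    then obtain x where x: "x \<in> F" "a \<in> cball x r" using assms(2) by auto
    then have "x \<in> e ` {..<card F}" using e by (simp add: bij_betw_imp_surj_on)
    then obtain i where "i < card F" "e i = x" by auto
    with x show "a \<in> (\<Union>i. U i)" by (auto simp: U_def intro!: exI[of _ i])
  qed
  then have "hausdorff_premeasure s \<delta> A \<le> (\<Sum>i. diameter_power s (U i))"
    using diam assms(3,4) by (intro hausdorff_premeasure_le_suminf) (auto simp: U_def intro: order_trans)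
  also have "\<dots> = (\<Sum>i<card F. diameter_power s (U i))"
    by (rule suminf_finite) (auto simp: U_def)
  also have "\<dots> \<le> (\<Sum>i<card F. ennreal ((2 * r) powr s))"
    by (intro sum_mono) (simp add: U_def pow)
  also have "\<dots> = ennreal (card F * (2 * r) powr s)"
    by (simp add: ennreal_mult ennreal_of_nat_eq_real_of_nat)
  finally show ?thesis .
qed

text \<open>
  Countable subadditivity, in the form needed for null sets: cover the \<open>n\<close>-th set with total
  \<open>\<epsilon>/2\<^sup>n\<^sup>+\<^sup>1\<close> and enumerate the resulting double sequence of sets.
\<close>
lemma hausdorff_premeasure_UN_eq_0:
  fixes A :: "nat \<Rightarrow> 'a::metric_space set"
  assumes "\<And>n. hausdorff_premeasure s \<delta> (A n) = 0"
  shows "hausdorff_premeasure s \<delta> (\<Union>n. A n) = 0"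
proof -
  have small: "hausdorff_premeasure s \<delta> (\<Union>n. A n) \<le> 0 + ennreal \<epsilon>" if "\<epsilon> > 0" for \<epsilon> :: real
  proof -
    have "\<forall>n. \<exists>U. (\<forall>i. bounded (U i) \<and> diameter (U i) \<le> \<delta>) \<and> A n \<subseteq> (\<Union>i. U i) \<and>
            (\<Sum>i. diameter_power s (U i)) < ennreal (\<epsilon> * (1/2) ^ Suc n)"
      (is "\<forall>n. ?P n")
    proof
      fix n
      have "hausdorff_premeasure s \<delta> (A n) < ennreal (\<epsilon> * (1/2) ^ Suc n)"
        using assms[of n] that by (simp add: ennreal_zero_less_mult_iff)
      then show "?P n"
        unfolding hausdorff_premeasure_def INF_less_iff
        by (simp only: Bex_def mem_Collect_eq conj_assoc)
    qed
    from choice[OF this] obtain U where U: "\<And>n i. bounded (U n i)" "\<And>n i. diameter (U n i) \<le> \<delta>"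
        "\<And>n. A n \<subseteq> (\<Union>i. U n i)"
        "\<And>n. (\<Sum>i. diameter_power s (U n i)) < ennreal (\<epsilon> * (1/2) ^ Suc n)"
      by blast
    define V where "V k = case_prod U (prod_decode k)" for k
    have "(\<Union>n. A n) \<subseteq> (\<Union>k. V k)"
    proof
      fix a assume "a \<in> (\<Union>n. A n)"
      then obtain n i where "a \<in> U n i" using U(3) by blast
      then have "a \<in> V (prod_encode (n, i))" by (simp add: V_def)
      then show "a \<in> (\<Union>k. V k)" by blast
    qed
    then have "hausdorff_premeasure s \<delta> (\<Union>n. A n) \<le> (\<Sum>k. diameter_power s (V k))"
      by (intro hausdorff_premeasure_le_suminf) (auto simp: V_def U split: prod.split)
    also have "\<dots> = (\<Sum>n i. diameter_power s (U n i))"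
      unfolding V_def
      by (rule suminf_ennreal_2dimen[where f = "\<lambda>x. diameter_power s (case_prod U x)"])
        (simp only: prod.case)
    also have "\<dots> \<le> (\<Sum>n. ennreal (\<epsilon> * (1/2) ^ Suc n))"
      using U(4) by (intro suminf_le) (auto intro: less_imp_le)
    also have "\<dots> = ennreal \<epsilon>"
      using sums_mult[OF power_half_series, of \<epsilon>] that by (intro suminf_ennreal_eq) auto
    finally show ?thesis by simp
  qed
  have "hausdorff_premeasure s \<delta> (\<Union>n. A n) \<le> 0"
    by (rule ennreal_le_epsilon) (rule small)
  then show ?thesis by simp
qed

lemma hausdorff_dim_le_of_null_above:
  assumes "0 \<le> N" "\<And>s. N < s \<Longrightarrow> hausdorff_measure s A = 0"
  shows "hausdorff_dim A \<le> ennreal N"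
proof (rule ennreal_le_epsilon)
  fix e :: real assume "0 < e"
  with assms have "hausdorff_dim A \<le> ennreal (N + e)"
    unfolding hausdorff_dim_def by (intro Inf_lower) (auto simp del: ennreal_plus)
  with assms(1) \<open>0 < e\<close> show "hausdorff_dim A \<le> ennreal N + ennreal e" by simp
qed

section \<open>Covering by balls of large measure\<close>

locale borel_prob_space = prob_space M for M :: "'a::metric_space measure" +
  assumes sets_eq_borel: "sets M = sets borel"

text \<open>
  A set all of whose finite separated subsets have bounded size is covered by the balls around
  one of maximal size, and disjointness of the half-radius balls bounds that size by the total
  mass.
\<close>
lemma (in borel_prob_space) finite_cover_of_measure_cball_ge:
  fixes v :: real
  assumes "0 < v"
    and v: "\<And>x. x \<in> A \<Longrightarrow> v \<le> prob (cball x (r / 2))"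
  obtains F where "finite F" "F \<subseteq> A" "A \<subseteq> (\<Union>x\<in>F. cball x r)" "card F * v \<le> 1"
proof -
  define separated where
    "separated F \<longleftrightarrow> finite F \<and> F \<subseteq> A \<and> (\<forall>x\<in>F. \<forall>y\<in>F. x \<noteq> y \<longrightarrow> r < dist x y)" for F
  have bound: "card F * v \<le> 1" if "separated F" for F
  proof -
    have disj: "disjoint_family_on (\<lambda>x. cball x (r / 2)) F"
      unfolding disjoint_family_on_def
    proof safe
      fix x y z assume xy: "x \<in> F" "y \<in> F" "x \<noteq> y" "z \<in> cball x (r / 2)" "z \<in> cball y (r / 2)"
      then have "r < dist x y" using that by (auto simp: separated_def)
      with xy dist_triangle2[of x y z] show "z \<in> {}" by (auto simp: dist_commute)
    qed
    have "card F * v = (\<Sum>x\<in>F. v)" by simp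
    also have "\<dots> \<le> (\<Sum>x\<in>F. prob (cball x (r / 2)))"
      using that v by (intro sum_mono) (auto simp: separated_def)
    also have "\<dots> = prob (\<Union>x\<in>F. cball x (r / 2))"
      using that disj by (intro finite_measure_finite_Union[symmetric]) (auto simp: separated_def sets_eq_borel)
    finally show ?thesis using prob_le_1 order_trans by blast
  qed
  have "card F \<le> nat \<lfloor>1 / v\<rfloor>" if "separated F" for F
    using bound[OF that] \<open>0 < v\<close> by (simp add: le_nat_floor pos_le_divide_eq)
  moreover have "separated {}" by (simp add: separated_def)
  ultimately obtain F where F: "separated F" and max: "\<And>G. separated G \<Longrightarrow> card G \<le> card F"
    using ex_has_greatest_nat[of separated "{}" card "Suc (nat \<lfloor>1 / v\<rfloor>)"] by (auto simp: less_Suc_eq_le)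
  have "A \<subseteq> (\<Union>x\<in>F. cball x r)"
  proof (rule ccontr)
    assume "\<not> ?thesis"
    then obtain a where a: "a \<in> A" "\<And>x. x \<in> F \<Longrightarrow> r < dist x a"
      by (force simp: not_le)
    with F have *: "separated (insert a F)" by (auto simp: separated_def dist_commute)
    (* Balls of negative radius are empty, so r is nonnegative and a differs from all points of F. *)
    have "0 \<le> r"
      using v[OF a(1)] \<open>0 < v\<close> by (cases "r < 0") auto
    then have "a \<notin> F" using a(2)[of a] by auto
    with F max[OF *] show False by (simp add: separated_def)
  qed
  with F bound[OF F] show thesis by (intro that) (auto simp: separated_def)
qed

section \<open>Volume growth\<close>

lemma intermediate_points_cball_subset:
  assumes "0 \<le> t" "t \<le> 1" "x \<in> cball c \<epsilon>" "y \<in> cball c R"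
  shows "intermediate_points t x y \<subseteq> cball c (t * R + 2 * \<epsilon>)"
proof
  fix z assume "z \<in> intermediate_points t x y"
  then have "dist c z \<le> dist c x + t * dist x y"
    using dist_triangle[of c z x] by (simp add: intermediate_points_def)
  also have "dist x y \<le> \<epsilon> + R"
    using assms dist_triangle3[of x y c] by simp
  then have "t * dist x y \<le> t * (\<epsilon> + R)"
    using assms(1) by (rule mult_left_mono)
  also have "t * \<epsilon> \<le> \<epsilon>"
    using assms order_trans[OF zero_le_dist[of c x]] by (intro mult_left_le_one_le) simp_all
  then have "t * (\<epsilon> + R) \<le> \<epsilon> + t * R" by (simp add: algebra_simps)
  finally show "z \<in> cball c (t * R + 2 * \<epsilon>)" using assms(3) by simp
qed

lemma (in borel_prob_space) BBL_p_imp_brunn_minkowski: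
  assumes "BBL_p p N M" "0 < p" "0 < N" "0 \<le> t" "t \<le> 1"
    and "A \<in> events" "B \<in> events" "C \<in> events"
    and C: "\<And>x y. x \<in> A \<Longrightarrow> y \<in> B \<Longrightarrow> intermediate_points t x y \<subseteq> C"
  shows "p_mean (ereal (p / (1 + N * p))) t (prob A) (prob B) \<le> prob C"
proof -
  have "BBL_exponent p N = ereal (p / (1 + N * p))"
  proof -
    have "- 1 / N < 0" using \<open>0 < N\<close> by simp
    with \<open>0 < p\<close> have "p \<noteq> - 1 / N" by linarith
    then show ?thesis by (simp add: BBL_exponent_def)
  qed
  moreover have "p_mean (ereal p) t (indicator A x) (indicator B y) \<le> indicator C z"
    if "z \<in> intermediate_points t x y" for x y z
    using C that \<open>0 < p\<close> by (auto simp: p_mean_def indicator_def)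
  moreover have "integral\<^sup>L M (indicator S) = prob S" "integrable M (indicator S :: 'a \<Rightarrow> real)"
    if "S \<in> events" for S
    using that by (auto simp: less_top[symmetric] sets.sets_into_space Int_absorb1 Int_absorb2)
  moreover have bbl: "integral\<^sup>L M h \<ge> p_mean (BBL_exponent p N) t (integral\<^sup>L M f) (integral\<^sup>L M g)"
    if "\<And>x. 0 \<le> f x" "\<And>x. 0 \<le> g x" "\<And>x. 0 \<le> h x"
      "integrable M f" "integrable M g" "integrable M h"
      "\<And>x y z. z \<in> intermediate_points t x y \<Longrightarrow> p_mean (ereal p) t (f x) (g y) \<le> h z"
    for f g h :: "'a \<Rightarrow> real"
    using assms(1,4,5) that unfolding BBL_p_def by simp
  ultimately show ?thesis
    using assms(6-8) bbl[of "indicator A" "indicator B" "indicator C"] by simp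
qed

lemma p_mean_ge_second:
  assumes "0 < q" "0 \<le> t" "t \<le> 1" "0 < a" "0 \<le> b"
  shows "t powr (1 / q) * b \<le> p_mean (ereal q) t a b"
proof (cases "b = 0")
  case False
  have "t powr (1 / q) * b = (t * b powr q) powr (1 / q)"
    using assms False by (simp add: powr_mult powr_powr)
  also have "\<dots> \<le> ((1 - t) * a powr q + t * b powr q) powr (1 / q)"
    using assms by (intro powr_mono2) auto
  finally show ?thesis using assms False by (simp add: p_mean_def)
qed (simp add: p_mean_def)

text \<open>
  The small set in the Brunn-Minkowski inequality must be a genuine ball of positive measure
  rather than the point \<open>x\<close>, which may have measure zero; its radius \<open>tR/2\<close> is absorbed by doubling
  the radius on the right-hand side, which costs only a constant.
\<close>
lemma (in borel_prob_space) BBL_p_imp_measure_cball_ge: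
  assumes "BBL_p p N M" "0 < p" "0 < N"
    and x: "x \<in> measure_support M" and t: "0 < t" "t \<le> 1" and "0 < R"
  shows "t powr (N + 1 / p) * prob (cball x R) \<le> prob (cball x (2 * t * R))"
proof -
  define \<epsilon> where "\<epsilon> = t * R / 2"
  have "\<epsilon> > 0" using t \<open>0 < R\<close> by (simp add: \<epsilon>_def)
  have "0 < emeasure M (ball x \<epsilon>)"
    using x \<open>\<epsilon> > 0\<close> by (auto simp: measure_support_def)
  also have "\<dots> \<le> emeasure M (cball x \<epsilon>)"
    by (intro emeasure_mono) (auto simp: sets_eq_borel)
  finally have pos: "0 < prob (cball x \<epsilon>)"
    by (simp add: emeasure_eq_measure)
  have q: "1 / (p / (1 + N * p)) = N + 1 / p" "0 < p / (1 + N * p)"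
    using \<open>0 < p\<close> \<open>0 < N\<close> by (auto simp: add_divide_distrib add_pos_pos)
  have "t powr (N + 1 / p) * prob (cball x R)
      \<le> p_mean (ereal (p / (1 + N * p))) t (prob (cball x \<epsilon>)) (prob (cball x R))"
    using p_mean_ge_second[OF q(2), of t "prob (cball x \<epsilon>)" "prob (cball x R)"] pos t
    unfolding q(1) by simp
  also have "\<dots> \<le> prob (cball x (t * R + 2 * \<epsilon>))"
    using assms t intermediate_points_cball_subset[of t _ x \<epsilon> _ R]
    by (intro BBL_p_imp_brunn_minkowski) (auto simp: sets_eq_borel)
  also have "t * R + 2 * \<epsilon> = 2 * t * R" by (simp add: \<epsilon>_def)
  finally show ?thesis .
qed

section \<open>Dimension of the support\<close>

text \<open>
  The base point \<open>c\<close> is taken in the support so that its unit ball has positive mass. Each ball of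
  radius \<open>R = n + 1\<close> around a point within distance \<open>n\<close> of \<open>c\<close> contains this unit ball, which makes
  the lower volume bound uniform.
\<close>
lemma (in borel_prob_space) BBL_p_imp_premeasure_bounded_part_eq_0:
  assumes bbl: "BBL_p p N M" "0 < p" "0 < N"
    and s: "N + 1 / p < s" and c: "c \<in> measure_support M" and "0 < \<delta>" "0 \<le> n"
  shows "hausdorff_premeasure s \<delta> (measure_support M \<inter> cball c n) = 0"
proof -
  define R where "R = n + 1"
  define m where "m = prob (cball c 1)"
  define D where "D = N + 1 / p"
  have "R > 0" using \<open>0 \<le> n\<close> by (simp add: R_def)
  have "D > 0" using bbl by (simp add: D_def add_pos_pos)
  have "D < s" using s by (simp add: D_def)
  have "0 < emeasure M (ball c 1)"
    using c by (auto simp: measure_support_def)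
  also have "\<dots> \<le> emeasure M (cball c 1)"
    by (intro emeasure_mono) (auto simp: sets_eq_borel)
  finally have "m > 0" by (simp add: m_def emeasure_eq_measure)
  have lower: "(r / (4 * R)) powr D * m \<le> prob (cball x (r / 2))"
    if "0 < r" "r \<le> 4 * R" "x \<in> measure_support M" "x \<in> cball c n" for x r
  proof -
    have "cball c 1 \<subseteq> cball x R"
    proof
      fix y assume "y \<in> cball c 1"
      with \<open>x \<in> cball c n\<close> dist_triangle3[of x y c] show "y \<in> cball x R" by (simp add: R_def)
    qed
    then have "m \<le> prob (cball x R)"
      unfolding m_def by (intro finite_measure_mono) (auto simp: sets_eq_borel)
    then have "(r / (4 * R)) powr D * m \<le> (r / (4 * R)) powr D * prob (cball x R)"
      by (intro mult_left_mono) auto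
    also have "\<dots> \<le> prob (cball x (2 * (r / (4 * R)) * R))"
      unfolding D_def using that \<open>R > 0\<close>
      by (intro BBL_p_imp_measure_cball_ge[OF bbl]) simp_all
    also have "2 * (r / (4 * R)) * R = r / 2" using \<open>R > 0\<close> by simp
    finally show ?thesis .
  qed
  define K where "K = 2 powr s * (4 * R) powr D / m"
  have upper: "hausdorff_premeasure s \<delta> (measure_support M \<inter> cball c n) \<le> ennreal (K * r powr (s - D))"
    if r: "0 < r" "r \<le> 4 * R" "2 * r \<le> \<delta>" for r
  proof -
    define v where "v = (r / (4 * R)) powr D * m"
    have "v > 0" using r \<open>R > 0\<close> \<open>m > 0\<close> by (simp add: v_def)
    have "v \<le> prob (cball x (r / 2))" if "x \<in> measure_support M \<inter> cball c n" for x
      unfolding v_def using lower[OF r(1,2)] that by simp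
    from finite_cover_of_measure_cball_ge[OF \<open>v > 0\<close> this]
    obtain F where F: "finite F" "measure_support M \<inter> cball c n \<subseteq> (\<Union>x\<in>F. cball x r)"
        "card F * v \<le> 1" .
    have "card F * (2 * r) powr s \<le> 1 / v * (2 * r) powr s"
      using F(3) \<open>v > 0\<close> by (intro mult_right_mono) (simp_all add: pos_le_divide_eq)
    also have "\<dots> = K * r powr (s - D)"
      using r(1) \<open>R > 0\<close> powr_divide[of r "4 * R" D] powr_mult[of 2 r s]
      by (simp add: v_def K_def powr_diff mult_ac)
    finally have "ennreal (card F * (2 * r) powr s) \<le> ennreal (K * r powr (s - D))"
      by (rule ennreal_leI)
    then show ?thesis
      using hausdorff_premeasure_le_of_finite_cover[OF F(1,2) r(1,3), of s] \<open>D > 0\<close> \<open>D < s\<close>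
      by simp
  qed
  have "((\<lambda>r. K * r powr (s - D)) \<longlongrightarrow> K * 0 powr (s - D)) (at_right 0)"
    using \<open>D < s\<close>
    by (intro tendsto_intros) (auto simp: eventually_at intro!: exI[of _ 1])
  then have lim: "((\<lambda>r. ennreal (K * r powr (s - D))) \<longlongrightarrow> ennreal 0) (at_right 0)"
    by (intro tendsto_ennrealI) simp
  have "\<forall>\<^sub>F r in at_right 0. r \<in> {0<..<min (4 * R) (\<delta> / 2)}"
    using \<open>R > 0\<close> \<open>0 < \<delta>\<close> by (intro eventually_at_right_real) simp
  then have "\<forall>\<^sub>F r in at_right 0.
      hausdorff_premeasure s \<delta> (measure_support M \<inter> cball c n) \<le> ennreal (K * r powr (s - D))"
    by (rule eventually_mono) (auto intro!: upper)
  with lim have "hausdorff_premeasure s \<delta> (measure_support M \<inter> cball c n) \<le> ennreal 0"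
    by (intro tendsto_lowerbound) auto
  then show ?thesis by simp
qed

theorem corollary3p5:
  fixes M :: "'a::metric_space measure" and N :: real
  assumes "N \<ge> 1"
    and "measured_length_space M"
    and "BBL N M"
  shows "hausdorff_dim (measure_support M) \<le> ennreal N"
proof (rule hausdorff_dim_le_of_null_above)
  interpret measured_length_space M by fact
  interpret borel_prob_space M by unfold_locales (rule sets_eq_borel)
  fix s :: real assume "N < s"
  (* This choice makes the exponent N + 1 / p the midpoint of N and s. *)
  define p where "p = 2 / (s - N)"
  have "0 < p" using \<open>N < s\<close> by (simp add: p_def)
  have p: "1 / p = (s - N) / 2" by (simp add: p_def)
  have "N + 1 / p < s" using \<open>N < s\<close> unfolding p by (simp add: field_simps)
  have "- 1 / N < 0" using \<open>N \<ge> 1\<close> by simp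
  then have "- 1 / N \<le> p" using \<open>0 < p\<close> by linarith
  then have "BBL_p p N M" using assms(3) by (simp add: BBL_def)
  have "hausdorff_premeasure s \<delta> (measure_support M) = 0" if "0 < \<delta>" for \<delta>
  proof (cases "measure_support M = {}")
    case True
    then have "hausdorff_premeasure s \<delta> (measure_support M) \<le> (\<Sum>i. diameter_power s ({} :: 'a set))"
      using \<open>0 < \<delta>\<close> by (intro hausdorff_premeasure_le_suminf) (auto simp: diameter_def)
    then show ?thesis by simp
  next
    case False
    then obtain c where "c \<in> measure_support M" by auto
    then have "hausdorff_premeasure s \<delta> (measure_support M \<inter> cball c (real n)) = 0" for n
      using BBL_p_imp_premeasure_bounded_part_eq_0[OF \<open>BBL_p p N M\<close> \<open>0 < p\<close> _
          \<open>N + 1 / p < s\<close> _ \<open>0 < \<delta>\<close>] \<open>N \<ge> 1\<close> by simp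
    then have "hausdorff_premeasure s \<delta> (\<Union>n. measure_support M \<inter> cball c (real n)) = 0"
      by (rule hausdorff_premeasure_UN_eq_0)
    also have "(\<Union>n. measure_support M \<inter> cball c (real n)) = measure_support M"
      using real_arch_simple by auto
    finally show ?thesis .
  qed
  then show "hausdorff_measure s (measure_support M) = 0"
    by (simp add: hausdorff_measure_def)
qed (use \<open>N \<ge> 1\<close> in simp)

end
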